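(* Let $\mathbf{A}$ be a fixed real $m\times n$ matrix, and let $\mathbf{X}=[X_{jk}]$ be a random $m\times n$ real matrix with independent entries for which $\mathbb{E}\mathbf{X}=\mathbf{A}$. Assume that, for some constant $D>0$, $|X_{jk}|\le D/2$ almost surely for all $j,k$. Then, for all $t>0$, \[ \mathbb{P}\left(\|\mathbf{A}-\mathbf{X}\|>\mathbb{E}\|\mathbf{A}-\mathbf{X}\|+t\right)\le e^{-t^2/(4D^2)}. \]
   Context: $\|\cdot\|$ denotes the spectral norm (largest singular value). The expectation of a random matrix is taken entrywise. *)

theory Defs
  imports "HOL-Probability.Probability"
begin

text \<open>
  Eigenvalues of \<open>transpose A ** A\<close> are nonnegative, so \<open>sqrt\<close> is the genuine square root here.
  For an \<open>m \<times> n\<close> matrix with \<open>m < n\<close> this set contains \<open>0\<close> even if \<open>A\<close> has full rank;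
  the largest element does not depend on that convention.
\<close>

definition singular_values :: "real^'n^'m \<Rightarrow> real set" where
  "singular_values A =
     {sqrt l | l. \<exists>v. v \<noteq> 0 \<and> (transpose A ** A) *v v = l *\<^sub>R v}"

definition spectral_norm :: "real^'n^'m \<Rightarrow> real" where
  "spectral_norm A = (GREATEST s. s \<in> singular_values A)"

definition matrix_expectation :: "'a measure \<Rightarrow> ('a \<Rightarrow> real^'n^'m) \<Rightarrow> real^'n^'m" where
  "matrix_expectation M X = (\<chi> j k. prob_space.expectation M (\<lambda>\<omega>. X \<omega> $ j $ k))"

lemma inner_transpose_mult:
  fixes A :: "real^'n^'m"
  shows "((transpose A ** A) *v v) \<bullet> w = (A *v v) \<bullet> (A *v w)"
proof -
  have "((transpose A ** A) *v v) \<bullet> w = (transpose A *v (A *v v)) \<bullet> w"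
    by (simp add: matrix_vector_mul_assoc)
  also have "\<dots> = (A *v v) \<bullet> (A *v w)"
    by (metis dot_lmul_matrix transpose_matrix_vector)
  finally show ?thesis .
qed

lemma singular_value_le_onorm:
  fixes A :: "real^'n^'m"
  assumes "s \<in> singular_values A"
  shows "s \<le> onorm ((*v) A)"
proof -
  obtain l v where s: "s = sqrt l" and v: "v \<noteq> 0" and e: "(transpose A ** A) *v v = l *\<^sub>R v"
    using assms unfolding singular_values_def by blast
  have "l * (norm v)\<^sup>2 = (norm (A *v v))\<^sup>2"
    using inner_transpose_mult[of A v v] e by (simp add: power2_norm_eq_inner)
  then have "l = (norm (A *v v) / norm v)\<^sup>2"
    using v by (simp add: field_simps)
  then have "s = norm (A *v v) / norm v"
    using s by simp
  also have "\<dots> \<le> onorm ((*v) A)"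
    by (rule le_onorm) (simp add: linear_linear)
  finally show ?thesis .
qed

lemma onorm_in_singular_values:
  fixes A :: "real^'n^'m"
  shows "onorm ((*v) A) \<in> singular_values A"
proof -
  have bl: "bounded_linear ((*v) A)" by (simp add: linear_linear)
  have "continuous_on (sphere 0 1) (\<lambda>v. norm (A *v v))"
    by (intro continuous_intros linear_continuous_on bl)
  moreover have "sphere (0::real^'n) 1 \<noteq> {}" by simp
  ultimately obtain v where v: "norm v = 1"
    and mx: "\<And>u. norm u = 1 \<Longrightarrow> norm (A *v u) \<le> norm (A *v v)"
    using continuous_attains_sup[OF compact_sphere, of 0 1 "\<lambda>v. norm (A *v v)"] by auto
  define c where "c = norm (A *v v)"
  have bnd: "norm (A *v u) \<le> c * norm u" for u
  proof (cases "u = 0")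
    case False
    then have "norm (A *v ((1 / norm u) *\<^sub>R u)) \<le> c"
      unfolding c_def by (intro mx) simp
    then show ?thesis using False
      by (simp add: matrix_vector_mult_scaleR field_simps)
  qed simp
  have c0: "0 \<le> c" by (simp add: c_def)
  have on: "onorm ((*v) A) = c"
  proof (rule antisym)
    show "onorm ((*v) A) \<le> c" by (rule onorm_bound[OF c0 bnd])
    show "c \<le> onorm ((*v) A)" using le_onorm[OF bl, of v] v by (simp add: c_def)
  qed
  define w where "w = c\<^sup>2 *\<^sub>R v - (transpose A ** A) *v v"
  define q where "q = c\<^sup>2 * (w \<bullet> w) - (A *v w) \<bullet> (A *v w)"
  have lin: "c\<^sup>2 * (v \<bullet> w) - (A *v v) \<bullet> (A *v w) = w \<bullet> w"
  proof -
    have "w \<bullet> w = c\<^sup>2 * (v \<bullet> w) - ((transpose A ** A) *v v) \<bullet> w"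
      by (subst w_def) (simp add: inner_diff_left)
    then show ?thesis by (simp only: inner_transpose_mult)
  qed
  have quad: "0 \<le> 2 * s * (w \<bullet> w) + s\<^sup>2 * q" for s
  proof -
    have "(norm (A *v (v + s *\<^sub>R w)))\<^sup>2 \<le> (c * norm (v + s *\<^sub>R w))\<^sup>2"
      by (intro power_mono bnd) simp
    moreover have "(norm (A *v (v + s *\<^sub>R w)))\<^sup>2
        = c\<^sup>2 + 2 * s * ((A *v v) \<bullet> (A *v w)) + s\<^sup>2 * ((A *v w) \<bullet> (A *v w))"
      unfolding c_def power2_norm_eq_inner
      by (simp add: matrix_vector_right_distrib matrix_vector_mult_scaleR inner_add_left
          inner_add_right inner_commute power2_eq_square algebra_simps)
    moreover have "(norm (v + s *\<^sub>R w))\<^sup>2 = 1 + 2 * s * (v \<bullet> w) + s\<^sup>2 * (w \<bullet> w)"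
    proof -
      have "v \<bullet> v = 1" using v by (simp add: norm_eq_1)
      then show ?thesis unfolding power2_norm_eq_inner
        by (simp add: inner_add_left inner_add_right inner_commute power2_eq_square algebra_simps)
    qed
    ultimately have "0 \<le> c\<^sup>2 * (1 + 2 * s * (v \<bullet> w) + s\<^sup>2 * (w \<bullet> w))
        - (c\<^sup>2 + 2 * s * ((A *v v) \<bullet> (A *v w)) + s\<^sup>2 * ((A *v w) \<bullet> (A *v w)))"
      by (simp add: power_mult_distrib)
    also have "\<dots> = 2 * s * (c\<^sup>2 * (v \<bullet> w) - (A *v v) \<bullet> (A *v w)) + s\<^sup>2 * q"
      by (simp add: q_def algebra_simps)
    finally show ?thesis by (simp only: lin)
  qed
  have "w \<bullet> w \<le> 0"
  proof (rule ccontr)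
    assume "\<not> w \<bullet> w \<le> 0"
    then have pos: "0 < w \<bullet> w" by linarith
    define s where "s = - (w \<bullet> w) / (1 + \<bar>q\<bar>)"
    have s: "s < 0" unfolding s_def using pos by (intro divide_neg_pos) auto
    have "\<bar>s * q\<bar> \<le> w \<bullet> w"
    proof -
      have "\<bar>s * q\<bar> = (w \<bullet> w) * (\<bar>q\<bar> / (1 + \<bar>q\<bar>))"
        unfolding s_def by (simp add: abs_mult)
      also have "\<dots> \<le> (w \<bullet> w) * 1"
        using pos by (intro mult_left_mono) auto
      finally show ?thesis by simp
    qed
    then have "0 < 2 * (w \<bullet> w) + s * q" using pos by linarith
    then have "s * (2 * (w \<bullet> w) + s * q) < 0" using s by (simp add: mult_neg_pos)
    with quad[of s] show False by (simp add: power2_eq_square algebra_simps)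
  qed
  then have "w = 0" by (metis inner_gt_zero_iff not_le)
  then have "(transpose A ** A) *v v = c\<^sup>2 *\<^sub>R v" by (simp add: w_def)
  moreover have "v \<noteq> 0" using v by auto
  moreover have "c = sqrt (c\<^sup>2)" using c0 by simp
  ultimately show ?thesis unfolding on singular_values_def by blast
qed

text \<open>In particular a largest singular value always exists.\<close>

lemma spectral_norm_eq_onorm:
  fixes A :: "real^'n^'m"
  shows "spectral_norm A = onorm ((*v) A)"
  unfolding spectral_norm_def
  by (intro Greatest_equality onorm_in_singular_values singular_value_le_onorm)

end

theory Submission
  imports Defs
begin

text \<open>
  The matrix \<open>X\<close> is a vector with independent coordinates in an interval of length \<open>D\<close>, and
  \<open>x \<mapsto> \<parallel>A - x\<parallel>\<close> is convex and 1-Lipschitz for the Frobenius norm. For convex Lipschitz \<open>\<phi>\<close> put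
  \<open>Q \<phi> x = inf\<^sub>u (\<phi> (x + u) + \<parallel>u\<parallel>\<^sup>2 / (4 D\<^sup>2))\<close>. Maurey's inequality
  \<open>E (exp (Q \<phi> X)) \<cdot> E (exp (- \<phi> X)) \<le> 1\<close> is proved by induction on the coordinates; convexity of
  \<open>\<phi>\<close> passes to \<open>Q \<phi>\<close> and, by Hoelder, to the logarithm of its partial exponential moments.
  Taking \<open>\<phi> = c f\<close>, one has \<open>Q \<phi> \<ge> \<phi> - c\<^sup>2 D\<^sup>2\<close>, while Jensen bounds the second factor below by
  \<open>exp (- c E f)\<close>; Markov's inequality with \<open>c = t / (2 D\<^sup>2)\<close> gives the tail bound.
\<close>

section \<open>A scalar interpolation inequality and the one-dimensional Maurey bound\<close>

text \<open>The exponent is a quadratic in \<theta> with minimiser \<open>\<theta> = 2 * s\<close>,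
  where its value is \<open>s - s^2\<close>. For \<open>s \<le> 1/2\<close> this choice is
  admissible. Beyond that \<theta> is capped at \<open>1\<close>, and the bound at
  \<open>1/2\<close> carries over because the right-hand side grows with \<open>s\<close>.\<close>

lemma talagrand_interpolation:
  fixes s :: real
  assumes "0 \<le> s"
  obtains \<theta> where "0 \<le> \<theta>" "\<theta> \<le> 1" "exp ((1 - \<theta>) * s + \<theta>\<^sup>2 / 4) \<le> 2 - exp (- s)"
proof -
  have small: "exp (r - r\<^sup>2) \<le> 2 - exp (- r)" if r: "0 \<le> r" "r \<le> 1 / 2" for r :: real
  proof -
    let ?h = "\<lambda>r::real. exp (r - r\<^sup>2) + exp (- r)"
    have "?h r \<le> ?h 0"
    proof (rule DERIV_nonpos_imp_nonincreasing[OF r(1)])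
      fix x :: real
      \<comment> \<open>The exponent on the right is chosen so that multiplying by
        \<open>exp (x - x^2)\<close> leaves \<open>exp (- x)\<close>, which makes the derivative of
        \<open>?h\<close> nonpositive. Since \<open>?h 0 = 2\<close>, the claim follows.\<close>
      have "1 - 2 * x \<le> exp (- 2 * x + x\<^sup>2)"
        using exp_ge_add_one_self[of "- 2 * x + x\<^sup>2"] zero_le_power2[of x] by linarith
      then have "(1 - 2 * x) * exp (x - x\<^sup>2) \<le> exp (- 2 * x + x\<^sup>2) * exp (x - x\<^sup>2)"
        by (intro mult_right_mono) simp_all
      also have "\<dots> = exp (- x)"
        by (simp flip: exp_add)
      finally have "(1 - 2 * x) * exp (x - x\<^sup>2) - exp (- x) \<le> 0" by simp
      moreover have "(?h has_real_derivative ((1 - 2 * x) * exp (x - x\<^sup>2) - exp (- x))) (at x)"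
        by (auto intro!: derivative_eq_intros)
      ultimately show "\<exists>y. (?h has_real_derivative y) (at x) \<and> y \<le> 0" by blast
    qed
    then show ?thesis by simp
  qed
  show thesis
  proof (cases "s \<le> 1 / 2")
    case True
    have "(1 - 2 * s) * s + (2 * s)\<^sup>2 / 4 = s - s\<^sup>2"
      by (simp add: power2_eq_square algebra_simps)
    then have "exp ((1 - 2 * s) * s + (2 * s)\<^sup>2 / 4) \<le> 2 - exp (- s)"
      using small[OF assms True] by (simp only:)
    then show thesis
      using that[of "2 * s"] assms True by linarith
  next
    case False
    have "exp (1 / 4 :: real) \<le> 2 - exp (- (1 / 2))"
      using small[of "1 / 2"] by (simp add: power2_eq_square)
    also have "\<dots> \<le> 2 - exp (- s)"
      using False by simp
    finally show thesis
      using that[of 1] by simp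
  qed
qed

text \<open>Here \<open>p\<close> stands for anything dominated by the exponential of the infimal
  convolution of \<psi>. Keeping it abstract lets the induction over coordinates insert a partial
  expectation. The proof compares each value of \<psi> with its minimum over the interval
  \<open>[-D/2, D/2]\<close>.\<close>

lemma (in prob_space) maurey_property_real:
  fixes \<xi> :: "'a \<Rightarrow> real"
  assumes D: "D > 0"
    and rv: "random_variable borel \<xi>"
    and bound: "\<And>\<omega>. \<bar>\<xi> \<omega>\<bar> \<le> D / 2"
    and conv: "convex_on UNIV \<psi>"
    and int: "integrable M (\<lambda>\<omega>. p (\<xi> \<omega>))"
    and p: "\<And>z w. p z \<le> exp (\<psi> w + (z - w)\<^sup>2 / (4 * D\<^sup>2))"
  shows "integrable M (\<lambda>\<omega>. exp (- \<psi> (\<xi> \<omega>)))"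
    and "expectation (\<lambda>\<omega>. p (\<xi> \<omega>)) * expectation (\<lambda>\<omega>. exp (- \<psi> (\<xi> \<omega>))) \<le> 1"
proof -
  have cont: "continuous_on UNIV \<psi>"
    by (rule convex_on_continuous[OF open_UNIV conv])
  then have "continuous_on {- (D / 2)..D / 2} \<psi>"
    by (rule continuous_on_subset) simp
  then obtain w where w: "w \<in> {- (D / 2)..D / 2}"
    and wmin: "\<And>z. z \<in> {- (D / 2)..D / 2} \<Longrightarrow> \<psi> w \<le> \<psi> z"
    using continuous_attains_inf[of "{- (D / 2)..D / 2}" \<psi>] D by auto
  have pointwise: "p (\<xi> \<omega>) \<le> exp (\<psi> w) * (2 - exp (\<psi> w - \<psi> (\<xi> \<omega>)))" for \<omega>
  proof -
    let ?z = "\<xi> \<omega>"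
    have z: "?z \<in> {- (D / 2)..D / 2}"
      using bound[of \<omega>] by (auto simp: abs_le_iff)
    then obtain \<theta> where \<theta>: "0 \<le> \<theta>" "\<theta> \<le> 1"
      "exp ((1 - \<theta>) * (\<psi> ?z - \<psi> w) + \<theta>\<^sup>2 / 4) \<le> 2 - exp (- (\<psi> ?z - \<psi> w))"
      using talagrand_interpolation[of "\<psi> ?z - \<psi> w"] wmin by auto
    \<comment> \<open>interpolating towards the minimiser \<open>w\<close> is a good enough competitor in the infimum\<close>
    define y where "y = (1 - \<theta>) *\<^sub>R ?z + \<theta> *\<^sub>R w"
    have "\<psi> y \<le> (1 - \<theta>) * \<psi> ?z + \<theta> * \<psi> w"
      unfolding y_def by (rule convex_onD[OF conv]) (use \<theta> in auto)
    \<comment> \<open>The range of \<xi> has length at most \<open>D\<close>, so the cost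
      \<open>1 / (4 * D^2)\<close> is exactly what turns the displacement into the term
      \<open>\<theta>^2 / 4\<close> of the scalar inequality.\<close>
    moreover have "(?z - y)\<^sup>2 / (4 * D\<^sup>2) \<le> \<theta>\<^sup>2 / 4"
    proof -
      have "\<bar>?z - w\<bar> \<le> \<bar>D\<bar>"
        using z w by auto
      then have "(?z - w)\<^sup>2 \<le> D\<^sup>2"
        by (simp only: abs_le_square_iff)
      moreover have "?z - y = \<theta> * (?z - w)"
        by (simp add: y_def algebra_simps)
      ultimately show ?thesis
        using D by (simp add: power_mult_distrib divide_simps mult_left_mono)
    qed
    ultimately have "\<psi> y + (?z - y)\<^sup>2 / (4 * D\<^sup>2)
        \<le> \<psi> w + ((1 - \<theta>) * (\<psi> ?z - \<psi> w) + \<theta>\<^sup>2 / 4)"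
      by (simp add: algebra_simps)
    then have "exp (\<psi> y + (?z - y)\<^sup>2 / (4 * D\<^sup>2))
        \<le> exp (\<psi> w) * exp ((1 - \<theta>) * (\<psi> ?z - \<psi> w) + \<theta>\<^sup>2 / 4)"
      by (simp flip: exp_add)
    also have "\<dots> \<le> exp (\<psi> w) * (2 - exp (\<psi> w - \<psi> ?z))"
      using \<theta>(3) by simp
    finally show ?thesis
      using p[of ?z y] by linarith
  qed
  have meas: "(\<lambda>\<omega>. exp (\<psi> w - \<psi> (\<xi> \<omega>))) \<in> borel_measurable M"
    using rv borel_measurable_continuous_onI[OF cont] by measurable
  have int_e: "integrable M (\<lambda>\<omega>. exp (\<psi> w - \<psi> (\<xi> \<omega>)))"
  proof (rule integrable_const_bound[where B = 1])
    show "AE \<omega> in M. norm (exp (\<psi> w - \<psi> (\<xi> \<omega>))) \<le> 1"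
    proof (rule AE_I2)
      fix \<omega>
      have "\<psi> w \<le> \<psi> (\<xi> \<omega>)"
        using bound[of \<omega>] by (intro wmin) (auto simp: abs_le_iff)
      then show "norm (exp (\<psi> w - \<psi> (\<xi> \<omega>))) \<le> 1" by simp
    qed
  qed (rule meas)
  have exp_\<psi>: "exp (- \<psi> (\<xi> \<omega>)) = exp (- \<psi> w) * exp (\<psi> w - \<psi> (\<xi> \<omega>))" for \<omega>
    by (simp flip: exp_add)
  show "integrable M (\<lambda>\<omega>. exp (- \<psi> (\<xi> \<omega>)))"
    unfolding exp_\<psi> by (intro integrable_mult_right int_e)
  \<comment> \<open>After the factors \<open>exp (\<psi> w)\<close> and
    \<open>exp (- \<psi> w)\<close> cancel, the product is at most
    \<open>(2 - r) * r = 1 - (r - 1)^2\<close>.\<close>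
  define r where "r = expectation (\<lambda>\<omega>. exp (\<psi> w - \<psi> (\<xi> \<omega>)))"
  have r0: "0 \<le> r" unfolding r_def by simp
  have "expectation (\<lambda>\<omega>. p (\<xi> \<omega>)) \<le> expectation (\<lambda>\<omega>. exp (\<psi> w) * (2 - exp (\<psi> w - \<psi> (\<xi> \<omega>))))"
    using pointwise int_e by (intro integral_mono int) auto
  also have "\<dots> = exp (\<psi> w) * (2 - r)"
    using int_e by (simp add: r_def prob_space)
  finally have 1: "expectation (\<lambda>\<omega>. p (\<xi> \<omega>)) \<le> exp (\<psi> w) * (2 - r)" .
  have 2: "expectation (\<lambda>\<omega>. exp (- \<psi> (\<xi> \<omega>))) = exp (- \<psi> w) * r"
    unfolding r_def exp_\<psi> by simp
  have "expectation (\<lambda>\<omega>. p (\<xi> \<omega>)) * expectation (\<lambda>\<omega>. exp (- \<psi> (\<xi> \<omega>)))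
      \<le> (exp (\<psi> w) * (2 - r)) * (exp (- \<psi> w) * r)"
    unfolding 2 by (rule mult_right_mono[OF 1]) (simp add: r0)
  also have "\<dots> = (2 - r) * r"
    by (simp add: exp_minus)
  also have "\<dots> \<le> 1"
    using zero_le_power2[of "r - 1"] by (simp add: power2_eq_square algebra_simps)
  finally show "expectation (\<lambda>\<omega>. p (\<xi> \<omega>)) * expectation (\<lambda>\<omega>. exp (- \<psi> (\<xi> \<omega>))) \<le> 1" .
qed

section \<open>Iterated expectations and convexity of logarithmic moments\<close>

text \<open>Independence makes the joint law a product, so this is Fubini's theorem pulled back to
  \<open>M\<close>. Both integrals run over \<open>M\<close> itself, so the induction can freeze one
  coordinate without changing the probability space.\<close>

lemma (in prob_space) expectation_indep_iterated:
  fixes h :: "'b \<times> 'b \<Rightarrow> real"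
  assumes ind: "indep_var S Y T Z"
    and h[measurable]: "h \<in> borel_measurable (S \<Otimes>\<^sub>M T)"
    and int: "integrable M (\<lambda>\<omega>. h (Y \<omega>, Z \<omega>))"
  shows "integrable M (\<lambda>\<omega>. expectation (\<lambda>\<omega>'. h (Y \<omega>, Z \<omega>')))"
    and "expectation (\<lambda>\<omega>. expectation (\<lambda>\<omega>'. h (Y \<omega>, Z \<omega>'))) = expectation (\<lambda>\<omega>. h (Y \<omega>, Z \<omega>))"
proof -
  have Y[measurable]: "random_variable S Y" and Z[measurable]: "random_variable T Z"
    and joint: "distr M S Y \<Otimes>\<^sub>M distr M T Z = distr M (S \<Otimes>\<^sub>M T) (\<lambda>\<omega>. (Y \<omega>, Z \<omega>))"
    using ind unfolding indep_var_distribution_eq by auto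
  interpret dY: prob_space "distr M S Y" by (rule prob_space_distr) fact
  interpret dZ: prob_space "distr M T Z" by (rule prob_space_distr) fact
  interpret P: pair_prob_space "distr M S Y" "distr M T Z" ..
  have P: "integrable (distr M S Y \<Otimes>\<^sub>M distr M T Z) h"
    unfolding joint by (subst integrable_distr_eq) (auto simp: int)
  have inner: "(\<integral>z. h (y, z) \<partial>distr M T Z) = expectation (\<lambda>\<omega>'. h (y, Z \<omega>'))"
    if "y \<in> space S" for y
    using that by (subst integral_distr) auto
  have meas: "(\<lambda>y. \<integral>z. h (y, z) \<partial>distr M T Z) \<in> borel_measurable S"
    using dZ.borel_measurable_lebesgue_integral[of "\<lambda>y z. h (y, z)" S] by simp
  have space: "Y \<omega> \<in> space S" if "\<omega> \<in> space M" for \<omega>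
    using measurable_space[OF Y that] .
  have "integrable M (\<lambda>\<omega>. \<integral>z. h (Y \<omega>, z) \<partial>distr M T Z)"
    using P.integrable_fst'[OF P] by (subst (asm) integrable_distr_eq) (auto simp: meas)
  then show "integrable M (\<lambda>\<omega>. expectation (\<lambda>\<omega>'. h (Y \<omega>, Z \<omega>')))"
    by (rule Bochner_Integration.integrable_cong[THEN iffD1, rotated -1]) (auto simp: inner space)
  have "expectation (\<lambda>\<omega>. expectation (\<lambda>\<omega>'. h (Y \<omega>, Z \<omega>')))
      = expectation (\<lambda>\<omega>. \<integral>z. h (Y \<omega>, z) \<partial>distr M T Z)"
    by (intro Bochner_Integration.integral_cong) (auto simp: inner space)
  also have "\<dots> = (\<integral>y. \<integral>z. h (y, z) \<partial>distr M T Z \<partial>distr M S Y)"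
    by (subst integral_distr[OF Y meas]) simp
  also have "\<dots> = expectation (\<lambda>\<omega>. h (Y \<omega>, Z \<omega>))"
    unfolding P.integral_fst'[OF P] joint by (subst integral_distr) auto
  finally show "expectation (\<lambda>\<omega>. expectation (\<lambda>\<omega>'. h (Y \<omega>, Z \<omega>')))
      = expectation (\<lambda>\<omega>. h (Y \<omega>, Z \<omega>))" .
qed

text \<open>This is Hoelder's inequality in logarithmic form. Subtracting \<open>?a\<close> and
  \<open>?c\<close> normalises the two exponential moments to \<open>1\<close>; convexity of
  \<open>exp\<close> is then applied pointwise and integrated.\<close>

lemma (in prob_space) ln_expectation_exp_convex:
  fixes F G H :: "'a \<Rightarrow> real"
  assumes F: "integrable M (\<lambda>\<omega>. exp (F \<omega>))" and G: "integrable M (\<lambda>\<omega>. exp (G \<omega>))"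
    and H: "integrable M (\<lambda>\<omega>. exp (H \<omega>))"
    and t: "0 \<le> t" "t \<le> 1"
    and le: "\<And>\<omega>. H \<omega> \<le> (1 - t) * F \<omega> + t * G \<omega>"
  shows "ln (expectation (\<lambda>\<omega>. exp (H \<omega>)))
      \<le> (1 - t) * ln (expectation (\<lambda>\<omega>. exp (F \<omega>))) + t * ln (expectation (\<lambda>\<omega>. exp (G \<omega>)))"
proof -
  have pos: "0 < expectation (\<lambda>\<omega>. exp (K \<omega>))" if "integrable M (\<lambda>\<omega>. exp (K \<omega>))" for K :: "'a \<Rightarrow> real"
    using that by (intro expectation_greater) auto
  let ?a = "ln (expectation (\<lambda>\<omega>. exp (F \<omega>)))"
  let ?c = "ln (expectation (\<lambda>\<omega>. exp (G \<omega>)))"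
  let ?m = "(1 - t) * ?a + t * ?c"
  have *: "exp (H \<omega>) \<le> exp ?m * ((1 - t) * (exp (F \<omega>) / exp ?a) + t * (exp (G \<omega>) / exp ?c))" for \<omega>
  proof -
    have "exp (H \<omega> - ?m) \<le> exp ((1 - t) *\<^sub>R (F \<omega> - ?a) + t *\<^sub>R (G \<omega> - ?c))"
      using le[of \<omega>] by (simp add: algebra_simps)
    also have "\<dots> \<le> (1 - t) * exp (F \<omega> - ?a) + t * exp (G \<omega> - ?c)"
      by (rule convex_onD[OF exp_convex]) (use t in auto)
    finally have "exp ?m * exp (H \<omega> - ?m) \<le> exp ?m * ((1 - t) * exp (F \<omega> - ?a) + t * exp (G \<omega> - ?c))"
      by simp
    then show ?thesis by (simp add: exp_diff)
  qed
  have "expectation (\<lambda>\<omega>. exp (H \<omega>))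
      \<le> expectation (\<lambda>\<omega>. exp ?m * ((1 - t) * (exp (F \<omega>) / exp ?a) + t * (exp (G \<omega>) / exp ?c)))"
    using F G H * by (intro integral_mono) auto
  also have "\<dots> = exp ?m * ((1 - t) * (expectation (\<lambda>\<omega>. exp (F \<omega>)) / exp ?a)
      + t * (expectation (\<lambda>\<omega>. exp (G \<omega>)) / exp ?c))"
    using F G by simp
  also have "\<dots> = exp ?m"
    using pos[OF F] pos[OF G] by simp
  finally have "ln (expectation (\<lambda>\<omega>. exp (H \<omega>))) \<le> ln (exp ?m)"
    using pos[OF H] by (simp only: ln_le_cancel_iff exp_gt_zero)
  then show ?thesis by (simp only: ln_exp)
qed

section \<open>Infimal convolution with a quadratic cost\<close>

text \<open>Restricting the shifts to \<open>S\<close> allows optimisation over some coordinates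
  while the others stay frozen: with \<open>S = span B\<close> only the coordinates in
  \<open>B\<close> move, and the ambient space is the same at every stage of the induction.\<close>

definition inf_conv :: "real \<Rightarrow> 'a set \<Rightarrow> ('a \<Rightarrow> real) \<Rightarrow> 'a::real_inner \<Rightarrow> real" where
  "inf_conv D S \<phi> x = (INF u\<in>S. \<phi> (x + u) + (norm u)\<^sup>2 / (4 * D\<^sup>2))"

text \<open>Completing the square: the loss \<open>L * norm u\<close> exceeds the quadratic cost by
  at most \<open>L^2 * D^2\<close>, with equality at \<open>norm u = 2 * L * D^2\<close>. This
  bounds the infimum from below and later produces the variance term of the moment bound.\<close>

lemma inf_conv_summand_ge:
  fixes \<phi> :: "'a::real_inner \<Rightarrow> real"
  assumes L: "L-lipschitz_on UNIV \<phi>" and D: "D > 0"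
  shows "\<phi> x - L\<^sup>2 * D\<^sup>2 \<le> \<phi> (x + u) + (norm u)\<^sup>2 / (4 * D\<^sup>2)"
proof -
  have "\<bar>\<phi> x - \<phi> (x + u)\<bar> \<le> L * norm u"
    using lipschitz_onD[OF L, of x "x + u"] by (simp add: dist_norm)
  moreover have "0 \<le> (norm u / (2 * D) - L * D)\<^sup>2"
    by simp
  then have "L * norm u \<le> (norm u)\<^sup>2 / (4 * D\<^sup>2) + L\<^sup>2 * D\<^sup>2"
    using D by (simp add: power2_diff power_divide power_mult_distrib mult.commute)
  ultimately show ?thesis by linarith
qed

lemma inf_conv_bdd_below:
  fixes \<phi> :: "'a::real_inner \<Rightarrow> real"
  assumes "L-lipschitz_on UNIV \<phi>" "D > 0"
  shows "bdd_below ((\<lambda>u. \<phi> (x + u) + (norm u)\<^sup>2 / (4 * D\<^sup>2)) ` S)"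
  using inf_conv_summand_ge[OF assms] by (intro bdd_belowI2)

lemma inf_conv_le:
  fixes \<phi> :: "'a::real_inner \<Rightarrow> real"
  assumes "L-lipschitz_on UNIV \<phi>" "D > 0" "u \<in> S"
  shows "inf_conv D S \<phi> x \<le> \<phi> (x + u) + (norm u)\<^sup>2 / (4 * D\<^sup>2)"
  unfolding inf_conv_def using inf_conv_bdd_below[OF assms(1,2)] assms(3) by (rule cINF_lower)

lemma inf_conv_ge:
  fixes \<phi> :: "'a::real_inner \<Rightarrow> real"
  assumes "L-lipschitz_on UNIV \<phi>" "D > 0" "S \<noteq> {}"
  shows "\<phi> x - L\<^sup>2 * D\<^sup>2 \<le> inf_conv D S \<phi> x"
  unfolding inf_conv_def using assms(3) inf_conv_summand_ge[OF assms(1,2)] by (rule cINF_greatest)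

lemma inf_conv_approx:
  fixes \<phi> :: "'a::real_inner \<Rightarrow> real"
  assumes "L-lipschitz_on UNIV \<phi>" "D > 0" "S \<noteq> {}" "e > 0"
  obtains u where "u \<in> S" "\<phi> (x + u) + (norm u)\<^sup>2 / (4 * D\<^sup>2) < inf_conv D S \<phi> x + e"
  using cINF_less_iff[OF assms(3) inf_conv_bdd_below[OF assms(1,2)], of x "inf_conv D S \<phi> x + e"]
    assms(4) unfolding inf_conv_def[symmetric] by auto

text \<open>A near-optimal shift at one point is also a competitor at the other point, with the same
  cost.\<close>

lemma inf_conv_lipschitz:
  fixes \<phi> :: "'a::real_inner \<Rightarrow> real"
  assumes L: "L-lipschitz_on UNIV \<phi>" and D: "D > 0" and S: "S \<noteq> {}"
  shows "L-lipschitz_on UNIV (inf_conv D S \<phi>)"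
proof (rule lipschitz_onI)
  have *: "inf_conv D S \<phi> x \<le> inf_conv D S \<phi> y + L * dist x y" for x y
  proof (rule field_le_epsilon)
    fix e :: real assume "0 < e"
    then obtain u where u: "u \<in> S" "\<phi> (y + u) + (norm u)\<^sup>2 / (4 * D\<^sup>2) < inf_conv D S \<phi> y + e"
      using inf_conv_approx[OF L D S] by blast
    have "\<bar>\<phi> (x + u) - \<phi> (y + u)\<bar> \<le> L * dist x y"
      using lipschitz_onD[OF L, of "x + u" "y + u"] by (simp add: dist_norm)
    then show "inf_conv D S \<phi> x \<le> inf_conv D S \<phi> y + L * dist x y + e"
      using inf_conv_le[OF L D u(1), of x] u(2) by linarith
  qed
  fix x y
  show "dist (inf_conv D S \<phi> x) (inf_conv D S \<phi> y) \<le> L * dist x y"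
    using *[of x y] *[of y x] by (simp add: dist_real_def dist_commute abs_le_iff)
qed (rule lipschitz_on_nonneg[OF L])

text \<open>The convexity gap equals \<open>t * (1 - t) * (norm (x - y))^2\<close>.\<close>

lemma convex_on_norm_power2: "convex_on UNIV (\<lambda>u::'a::real_inner. (norm u)\<^sup>2)"
proof (rule convex_onI)
  fix t :: real and x y :: 'a
  assume t: "0 < t" "t < 1"
  have "(1 - t) * (norm x)\<^sup>2 + t * (norm y)\<^sup>2 - (norm ((1 - t) *\<^sub>R x + t *\<^sub>R y))\<^sup>2
      = t * (1 - t) * (norm (x - y))\<^sup>2"
    unfolding power2_norm_eq_inner
    by (simp add: inner_diff_left inner_diff_right inner_add_left inner_add_right inner_commute
        algebra_simps)
  moreover have "0 \<le> t * (1 - t) * (norm (x - y))\<^sup>2"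
    using t by simp
  ultimately show "(norm ((1 - t) *\<^sub>R x + t *\<^sub>R y))\<^sup>2 \<le> (1 - t) * (norm x)\<^sup>2 + t * (norm y)\<^sup>2"
    by linarith
qed simp

text \<open>The minimised expression is jointly convex in the point and the shift, so convex
  combinations of near-optimal shifts, which stay in \<open>S\<close>, are good competitors.\<close>

lemma inf_conv_convex:
  fixes \<phi> :: "'a::real_inner \<Rightarrow> real"
  assumes L: "L-lipschitz_on UNIV \<phi>" and D: "D > 0" and S: "S \<noteq> {}"
    and cS: "convex S" and conv: "convex_on UNIV \<phi>"
  shows "convex_on UNIV (inf_conv D S \<phi>)"
proof (rule convex_onI)
  fix t :: real and x y :: 'a
  assume t: "0 < t" "t < 1"
  show "inf_conv D S \<phi> ((1 - t) *\<^sub>R x + t *\<^sub>R y)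
      \<le> (1 - t) * inf_conv D S \<phi> x + t * inf_conv D S \<phi> y"
  proof (rule field_le_epsilon)
    fix e :: real assume e: "0 < e"
    obtain u where u: "u \<in> S" "\<phi> (x + u) + (norm u)\<^sup>2 / (4 * D\<^sup>2) < inf_conv D S \<phi> x + e"
      using inf_conv_approx[OF L D S e] by blast
    obtain v where v: "v \<in> S" "\<phi> (y + v) + (norm v)\<^sup>2 / (4 * D\<^sup>2) < inf_conv D S \<phi> y + e"
      using inf_conv_approx[OF L D S e] by blast
    let ?w = "(1 - t) *\<^sub>R u + t *\<^sub>R v"
    have w: "?w \<in> S"
      using cS u(1) v(1) t by (simp add: convexD)
    have "(1 - t) *\<^sub>R x + t *\<^sub>R y + ?w = (1 - t) *\<^sub>R (x + u) + t *\<^sub>R (y + v)"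
      by (simp add: algebra_simps)
    then have "\<phi> ((1 - t) *\<^sub>R x + t *\<^sub>R y + ?w) \<le> (1 - t) * \<phi> (x + u) + t * \<phi> (y + v)"
      using convex_onD[OF conv, of t "x + u" "y + v"] t by simp
    moreover have "(norm ?w)\<^sup>2 / (4 * D\<^sup>2)
        \<le> (1 - t) * ((norm u)\<^sup>2 / (4 * D\<^sup>2)) + t * ((norm v)\<^sup>2 / (4 * D\<^sup>2))"
      using divide_right_mono[OF convex_onD[OF convex_on_norm_power2, of t u v], of "4 * D\<^sup>2"] t
      by (simp add: add_divide_distrib)
    moreover have "(1 - t) * (\<phi> (x + u) + (norm u)\<^sup>2 / (4 * D\<^sup>2))
        \<le> (1 - t) * (inf_conv D S \<phi> x + e)"
      using u t by (intro mult_left_mono) auto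
    moreover have "t * (\<phi> (y + v) + (norm v)\<^sup>2 / (4 * D\<^sup>2)) \<le> t * (inf_conv D S \<phi> y + e)"
      using v t by (intro mult_left_mono) auto
    ultimately show "inf_conv D S \<phi> ((1 - t) *\<^sub>R x + t *\<^sub>R y)
        \<le> (1 - t) * inf_conv D S \<phi> x + t * inf_conv D S \<phi> y + e"
      using inf_conv_le[OF L D w, of "(1 - t) *\<^sub>R x + t *\<^sub>R y"] by (simp add: algebra_simps)
  qed
qed simp

lemma inf_conv_shift:
  "inf_conv D S (\<lambda>x. \<phi> (x + a)) x = inf_conv D S \<phi> (x + a)"
  by (simp add: inf_conv_def add_ac)

text \<open>By Pythagoras the quadratic cost is additive over orthogonal shifts. A move
  \<open>v\<close> in a new direction can therefore be paid for separately from the optimisation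
  over \<open>S\<close>.\<close>

lemma inf_conv_split_le:
  fixes \<phi> :: "'a::real_inner \<Rightarrow> real"
  assumes L: "L-lipschitz_on UNIV \<phi>" and D: "D > 0" and S: "S \<noteq> {}"
    and T: "\<And>u. u \<in> S \<Longrightarrow> u + v \<in> T" and orth: "\<And>u. u \<in> S \<Longrightarrow> u \<bullet> v = 0"
  shows "inf_conv D T \<phi> x \<le> inf_conv D S \<phi> (x + v) + (norm v)\<^sup>2 / (4 * D\<^sup>2)"
proof (rule field_le_epsilon)
  fix e :: real assume "0 < e"
  then obtain u where u: "u \<in> S"
    "\<phi> (x + v + u) + (norm u)\<^sup>2 / (4 * D\<^sup>2) < inf_conv D S \<phi> (x + v) + e"
    using inf_conv_approx[OF L D S] by blast
  have "(norm (u + v))\<^sup>2 = (norm u)\<^sup>2 + (norm v)\<^sup>2"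
    using orth[OF u(1)]
    unfolding power2_norm_eq_inner by (simp add: inner_add_left inner_add_right inner_commute)
  then show "inf_conv D T \<phi> x \<le> inf_conv D S \<phi> (x + v) + (norm v)\<^sup>2 / (4 * D\<^sup>2) + e"
    using inf_conv_le[OF L D T[OF u(1)], of x] u(2)
    by (simp add: add_divide_distrib add_ac)
qed

section \<open>Translates, exponential integrability and independence of partial sums\<close>

lemma lipschitz_on_shift:
  fixes \<phi> :: "'a::real_normed_vector \<Rightarrow> real"
  assumes "L-lipschitz_on UNIV \<phi>"
  shows "L-lipschitz_on UNIV (\<lambda>x. \<phi> (x + a))"
proof (rule lipschitz_onI)
  show "dist (\<phi> (x + a)) (\<phi> (y + a)) \<le> L * dist x y" for x y
    using lipschitz_onD[OF assms, of "x + a" "y + a"] by (simp add: dist_norm)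
qed (rule lipschitz_on_nonneg[OF assms])

lemma convex_on_shift:
  fixes \<phi> :: "'a::real_vector \<Rightarrow> real"
  assumes "convex_on UNIV \<phi>"
  shows "convex_on UNIV (\<lambda>x. \<phi> (x + a))"
proof (rule convex_onI)
  fix t :: real and x y :: 'a
  assume t: "0 < t" "t < 1"
  have "(1 - t) *\<^sub>R x + t *\<^sub>R y + a = (1 - t) *\<^sub>R (x + a) + t *\<^sub>R (y + a)"
    by (simp add: algebra_simps)
  then show "\<phi> ((1 - t) *\<^sub>R x + t *\<^sub>R y + a) \<le> (1 - t) * \<phi> (x + a) + t * \<phi> (y + a)"
    using convex_onD[OF assms, of t "x + a" "y + a"] t by simp
qed simp

lemma (in prob_space) integrable_exp_lipschitz:
  fixes \<phi> :: "'b::euclidean_space \<Rightarrow> real"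
  assumes L: "L-lipschitz_on UNIV \<phi>"
    and Y[measurable]: "random_variable borel Y"
    and R: "\<And>\<omega>. norm (Y \<omega>) \<le> R"
  shows "integrable M (\<lambda>\<omega>. exp (\<phi> (Y \<omega>)))"
proof (rule integrable_const_bound[where B = "exp (\<phi> 0 + L * R)"])
  have "\<phi> (Y \<omega>) \<le> \<phi> 0 + L * R" for \<omega>
  proof -
    have "\<bar>\<phi> (Y \<omega>) - \<phi> 0\<bar> \<le> L * norm (Y \<omega>)"
      using lipschitz_onD[OF L, of "Y \<omega>" 0] by (simp add: dist_norm)
    moreover have "L * norm (Y \<omega>) \<le> L * R"
      by (intro mult_left_mono R lipschitz_on_nonneg[OF L])
    ultimately show ?thesis by linarith
  qed
  then show "AE \<omega> in M. norm (exp (\<phi> (Y \<omega>))) \<le> exp (\<phi> 0 + L * R)" by simp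
  have [measurable]: "\<phi> \<in> borel_measurable borel"
    by (rule borel_measurable_continuous_onI[OF lipschitz_on_continuous_on[OF L]])
  show "(\<lambda>\<omega>. exp (\<phi> (Y \<omega>))) \<in> borel_measurable M" by measurable
qed

text \<open>The two vectors are measurable functions of the restrictions of the family to the
  disjoint index sets \<open>{b}\<close> and \<open>B\<close>.\<close>

lemma (in prob_space) indep_var_scaleR_sum:
  fixes \<xi> :: "'i \<Rightarrow> 'a \<Rightarrow> real" and e :: "'i \<Rightarrow> 'b::euclidean_space"
  assumes B: "finite B" "b \<notin> B" and ind: "indep_vars (\<lambda>_. borel) \<xi> (insert b B)"
  shows "indep_var borel (\<lambda>\<omega>. \<xi> b \<omega> *\<^sub>R e b) borel (\<lambda>\<omega>. \<Sum>i\<in>B. \<xi> i \<omega> *\<^sub>R e i)"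
proof -
  have "indep_var
      borel ((\<lambda>f. f b *\<^sub>R e b) \<circ> (\<lambda>\<omega>. restrict (\<lambda>i. \<xi> i \<omega>) {b}))
      borel ((\<lambda>f. \<Sum>i\<in>B. f i *\<^sub>R e i) \<circ> (\<lambda>\<omega>. restrict (\<lambda>i. \<xi> i \<omega>) B))"
    using B by (intro indep_var_compose[OF indep_var_restrict[OF ind]]) auto
  also have "(\<lambda>f. f b *\<^sub>R e b) \<circ> (\<lambda>\<omega>. restrict (\<lambda>i. \<xi> i \<omega>) {b}) = (\<lambda>\<omega>. \<xi> b \<omega> *\<^sub>R e b)"
    by auto
  also have "(\<lambda>f. \<Sum>i\<in>B. f i *\<^sub>R e i) \<circ> (\<lambda>\<omega>. restrict (\<lambda>i. \<xi> i \<omega>) B)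
      = (\<lambda>\<omega>. \<Sum>i\<in>B. \<xi> i \<omega> *\<^sub>R e i)"
    by (auto intro!: sum.cong)
  finally show ?thesis .
qed

section \<open>Maurey's inequality by induction on the coordinates\<close>

text \<open>In the induction step the new coordinate is frozen at \<open>z\<close>. The induction
  hypothesis handles the remaining coordinates for each \<open>z\<close>, and the one-dimensional
  bound then integrates over the new one.\<close>

lemma (in prob_space) maurey_property_sum:
  fixes \<xi> :: "'b::euclidean_space \<Rightarrow> 'a \<Rightarrow> real"
  assumes D: "D > 0"
    and B: "B \<subseteq> Basis"
    and ind: "indep_vars (\<lambda>_. borel) \<xi> B"
    and bound: "\<And>b \<omega>. b \<in> B \<Longrightarrow> \<bar>\<xi> b \<omega>\<bar> \<le> D / 2"
    and L: "L-lipschitz_on UNIV \<phi>"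
    and conv: "convex_on UNIV \<phi>"
  shows "expectation (\<lambda>\<omega>. exp (inf_conv D (span B) \<phi> (\<Sum>b\<in>B. \<xi> b \<omega> *\<^sub>R b)))
      * expectation (\<lambda>\<omega>. exp (- \<phi> (\<Sum>b\<in>B. \<xi> b \<omega> *\<^sub>R b))) \<le> 1"
proof -
  have "finite B"
    using B finite_Basis by (rule finite_subset)
  then show ?thesis
    using B ind bound L conv
  \<comment> \<open>The function \<phi> is generalised because the hypothesis is applied to its
    translates by \<open>z *\<^sub>R b\<close>.\<close>
  proof (induction B arbitrary: \<phi> rule: finite_induct)
    case empty
    \<comment> \<open>The span of the empty set is \<open>{0}\<close>, so the convolution at
      \<open>0\<close> is \<open>\<phi> 0\<close> and the two factors are reciprocal.\<close>
    then show ?case by (simp add: inf_conv_def prob_space exp_minus)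
  next
    case (insert b B)
    note L = insert.prems(4) and conv = insert.prems(5)
    have ind_B: "indep_vars (\<lambda>_. borel) \<xi> B"
      using insert.prems(2) by (rule indep_vars_subset) auto
    have [measurable]: "random_variable borel (\<xi> i)" if "i \<in> insert b B" for i
      using insert.prems(2) that by (auto simp: indep_vars_def)
    define Y where "Y = (\<lambda>\<omega>. \<Sum>i\<in>B. \<xi> i \<omega> *\<^sub>R i)"
    have [measurable]: "random_variable borel Y"
      unfolding Y_def by (intro borel_measurable_sum) simp
    have YR: "norm (Y \<omega>) \<le> card B * (D / 2)" for \<omega>
    proof -
      have "norm (\<xi> i \<omega> *\<^sub>R i) \<le> D / 2" if "i \<in> B" for i
        using insert.prems(1,3) that by (auto simp: subset_iff)
      then show ?thesis
        unfolding Y_def by (rule sum_norm_bound)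
    qed
    have Yz: "norm (Y \<omega> + z *\<^sub>R b) \<le> card B * (D / 2) + norm (z *\<^sub>R b)" for \<omega> z
      using norm_triangle_ineq[of "Y \<omega>" "z *\<^sub>R b"] YR[of \<omega>] by linarith
    have Yxi: "norm (Y \<omega> + \<xi> b \<omega> *\<^sub>R b) \<le> card B * (D / 2) + D / 2" for \<omega>
      using Yz[of \<omega> "\<xi> b \<omega>"] insert.prems(1) insert.prems(3)[of b \<omega>] by simp
    have sum_eq: "(\<Sum>i\<in>insert b B. \<xi> i \<omega> *\<^sub>R i) = Y \<omega> + \<xi> b \<omega> *\<^sub>R b" for \<omega>
      using insert.hyps by (simp add: Y_def)
    have indep: "indep_var borel (\<lambda>\<omega>. \<xi> b \<omega> *\<^sub>R b) borel Y"
      unfolding Y_def using indep_var_scaleR_sum[OF insert.hyps insert.prems(2), of "\<lambda>i. i"] .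
    have iterated: "integrable M (\<lambda>\<omega>. expectation (\<lambda>\<omega>'. exp (g (Y \<omega>' + \<xi> b \<omega> *\<^sub>R b))))"
      "expectation (\<lambda>\<omega>. expectation (\<lambda>\<omega>'. exp (g (Y \<omega>' + \<xi> b \<omega> *\<^sub>R b))))
        = expectation (\<lambda>\<omega>. exp (g (Y \<omega> + \<xi> b \<omega> *\<^sub>R b)))"
      if g: "L-lipschitz_on UNIV g" for g :: "'b \<Rightarrow> real"
    proof -
      have [measurable]: "g \<in> borel_measurable borel"
        by (rule borel_measurable_continuous_onI[OF lipschitz_on_continuous_on[OF g]])
      have h: "(\<lambda>(z, y). exp (g (y + z))) \<in> borel_measurable (borel \<Otimes>\<^sub>M borel)"
        by measurable
      have int: "integrable M (\<lambda>\<omega>. exp (g (Y \<omega> + \<xi> b \<omega> *\<^sub>R b)))"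
        by (rule integrable_exp_lipschitz[OF g _ Yxi]) simp
      show "integrable M (\<lambda>\<omega>. expectation (\<lambda>\<omega>'. exp (g (Y \<omega>' + \<xi> b \<omega> *\<^sub>R b))))"
        "expectation (\<lambda>\<omega>. expectation (\<lambda>\<omega>'. exp (g (Y \<omega>' + \<xi> b \<omega> *\<^sub>R b))))
          = expectation (\<lambda>\<omega>. exp (g (Y \<omega> + \<xi> b \<omega> *\<^sub>R b)))"
        using expectation_indep_iterated[OF indep h] int by simp_all
    qed
    let ?Q = "inf_conv D (span (insert b B)) \<phi>" and ?Q' = "inf_conv D (span B) \<phi>"
    have LQ: "L-lipschitz_on UNIV ?Q" "L-lipschitz_on UNIV ?Q'"
      using span_zero by (blast intro: inf_conv_lipschitz[OF L D])+
    have int_z: "integrable M (\<lambda>\<omega>. exp (g (Y \<omega> + z *\<^sub>R b)))"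
      if "L-lipschitz_on UNIV g" for g :: "'b \<Rightarrow> real" and z
      by (rule integrable_exp_lipschitz[OF that _ Yz]) simp
    have pos: "0 < expectation (\<lambda>\<omega>. exp (g (Y \<omega> + z *\<^sub>R b)))"
      if "L-lipschitz_on UNIV g" for g :: "'b \<Rightarrow> real" and z
      using int_z[OF that] by (intro expectation_greater) auto
    \<comment> \<open>With the new coordinate frozen at \<open>z\<close>, \<open>p\<close> averages
      the exponential of the full convolution, while \<psi> is the logarithmic moment of the
      convolution along the old coordinates only. These are the inputs of the one-dimensional
      bound.\<close>
    define p where "p z = expectation (\<lambda>\<omega>. exp (?Q (Y \<omega> + z *\<^sub>R b)))" for z
    define \<psi> where "\<psi> z = ln (expectation (\<lambda>\<omega>. exp (?Q' (Y \<omega> + z *\<^sub>R b))))" for z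
    have exp_\<psi>: "exp (\<psi> z) = expectation (\<lambda>\<omega>. exp (?Q' (Y \<omega> + z *\<^sub>R b)))" for z
      unfolding \<psi>_def using pos[OF LQ(2)] by simp
    have orth: "u \<bullet> (c *\<^sub>R b) = 0" if "u \<in> span B" for u c
    proof -
      have "orthogonal b u"
        using that
      proof (rule orthogonal_to_span)
        fix y assume "y \<in> B"
        then show "orthogonal b y"
          using insert.prems(1) insert.hyps(2) by (auto simp: orthogonal_def intro: inner_not_same_Basis)
      qed
      then show ?thesis by (simp add: orthogonal_def inner_commute)
    qed
    have p_le: "p z \<le> exp (\<psi> w + (z - w)\<^sup>2 / (4 * D\<^sup>2))" for z w
    proof -
      have "?Q (Y \<omega> + z *\<^sub>R b) \<le> ?Q' (Y \<omega> + w *\<^sub>R b) + (z - w)\<^sup>2 / (4 * D\<^sup>2)" for \<omega>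
      proof -
        \<comment> \<open>The competitor moves the new coordinate from \<open>z\<close> to
          \<open>w\<close>, orthogonally to \<open>span B\<close>.\<close>
        have "?Q (Y \<omega> + z *\<^sub>R b) \<le> ?Q' (Y \<omega> + z *\<^sub>R b + (w - z) *\<^sub>R b)
            + (norm ((w - z) *\<^sub>R b))\<^sup>2 / (4 * D\<^sup>2)"
        proof (rule inf_conv_split_le[OF L D])
          show "span B \<noteq> {}" using span_zero by blast
          show "u + (w - z) *\<^sub>R b \<in> span (insert b B)" if "u \<in> span B" for u
            using that span_mono[of B "insert b B"] span_base[of b "insert b B"]
            by (intro span_add span_scale) auto
        qed (rule orth)
        moreover have "Y \<omega> + z *\<^sub>R b + (w - z) *\<^sub>R b = Y \<omega> + w *\<^sub>R b"
          by (simp add: algebra_simps)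
        moreover have "(norm ((w - z) *\<^sub>R b))\<^sup>2 = (z - w)\<^sup>2"
          using insert.prems(1) by (simp add: power2_commute)
        ultimately show ?thesis by simp
      qed
      then have "p z \<le> expectation (\<lambda>\<omega>. exp (?Q' (Y \<omega> + w *\<^sub>R b)) * exp ((z - w)\<^sup>2 / (4 * D\<^sup>2)))"
        unfolding p_def
        by (intro integral_mono integrable_mult_left int_z LQ) (simp flip: exp_add)
      also have "\<dots> = exp (\<psi> w + (z - w)\<^sup>2 / (4 * D\<^sup>2))"
        by (simp add: exp_\<psi> exp_add)
      finally show ?thesis .
    qed
    have conv_\<psi>: "convex_on UNIV \<psi>"
    proof (rule convex_onI)
      fix t x y :: real
      assume t: "0 < t" "t < 1"
      have convQ: "convex_on UNIV ?Q'"
        using span_zero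
        by (blast intro: inf_conv_convex[OF L D] subspace_imp_convex subspace_span conv)
      have "?Q' (Y \<omega> + ((1 - t) * x + t * y) *\<^sub>R b)
          \<le> (1 - t) * ?Q' (Y \<omega> + x *\<^sub>R b) + t * ?Q' (Y \<omega> + y *\<^sub>R b)" for \<omega>
      proof -
        have "Y \<omega> + ((1 - t) * x + t * y) *\<^sub>R b
            = (1 - t) *\<^sub>R (Y \<omega> + x *\<^sub>R b) + t *\<^sub>R (Y \<omega> + y *\<^sub>R b)"
          by (simp add: algebra_simps)
        then show ?thesis
          using convex_onD[OF convQ, of t "Y \<omega> + x *\<^sub>R b" "Y \<omega> + y *\<^sub>R b"] t by simp
      qed
      then show "\<psi> ((1 - t) *\<^sub>R x + t *\<^sub>R y) \<le> (1 - t) * \<psi> x + t * \<psi> y"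
        unfolding \<psi>_def using t by (intro ln_expectation_exp_convex int_z LQ) auto
    qed simp
    have IH: "expectation (\<lambda>\<omega>. exp (- \<phi> (Y \<omega> + z *\<^sub>R b))) \<le> exp (- \<psi> z)" for z
    proof -
      have "exp (\<psi> z) * expectation (\<lambda>\<omega>. exp (- \<phi> (Y \<omega> + z *\<^sub>R b))) \<le> 1"
        using insert.IH[OF _ ind_B _ lipschitz_on_shift[OF L, of "z *\<^sub>R b"]
              convex_on_shift[OF conv, of "z *\<^sub>R b"]] insert.prems(1,3)
        unfolding inf_conv_shift exp_\<psi> Y_def by simp
      then show ?thesis
        by (simp add: exp_minus field_simps)
    qed
    have Lm: "L-lipschitz_on UNIV (\<lambda>x. - \<phi> x)"
      using L by (rule lipschitz_on_minus)
    have "integrable M (\<lambda>\<omega>. p (\<xi> b \<omega>))"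
      unfolding p_def by (rule iterated(1)[OF LQ(1)])
    note one_dim = maurey_property_real[OF D _ _ conv_\<psi> this p_le]
    have int_\<psi>: "integrable M (\<lambda>\<omega>. exp (- \<psi> (\<xi> b \<omega>)))"
      by (rule one_dim(1)) (use insert.prems(3) in auto)
    \<comment> \<open>The bound for frozen \<open>z\<close> is averaged over the law of the new
      coordinate.\<close>
    have "expectation (\<lambda>\<omega>. exp (- \<phi> (Y \<omega> + \<xi> b \<omega> *\<^sub>R b))) \<le> expectation (\<lambda>\<omega>. exp (- \<psi> (\<xi> b \<omega>)))"
      unfolding iterated(2)[OF Lm, symmetric]
      by (intro integral_mono iterated(1)[OF Lm] int_\<psi> IH)
    then have "expectation (\<lambda>\<omega>. exp (?Q (Y \<omega> + \<xi> b \<omega> *\<^sub>R b)))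
        * expectation (\<lambda>\<omega>. exp (- \<phi> (Y \<omega> + \<xi> b \<omega> *\<^sub>R b)))
        \<le> expectation (\<lambda>\<omega>. p (\<xi> b \<omega>)) * expectation (\<lambda>\<omega>. exp (- \<psi> (\<xi> b \<omega>)))"
      unfolding p_def iterated(2)[OF LQ(1)] by (intro mult_left_mono) auto
    also have "\<dots> \<le> 1"
      by (rule one_dim(2)) (use insert.prems(3) in auto)
    finally show ?case by (simp only: sum_eq)
  qed
qed

section \<open>Concentration of convex Lipschitz functions\<close>

lemma (in prob_space) convex_lipschitz_concentration:
  fixes X :: "'a \<Rightarrow> 'b::euclidean_space"
  assumes D: "D > 0"
    and ind: "indep_vars (\<lambda>_. borel) (\<lambda>b \<omega>. X \<omega> \<bullet> b) Basis"
    and bound: "\<And>b \<omega>. b \<in> Basis \<Longrightarrow> \<bar>X \<omega> \<bullet> b\<bar> \<le> D / 2"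
    and L: "1-lipschitz_on UNIV f"
    and conv: "convex_on UNIV f"
    and t: "t > 0"
  shows "prob {\<omega> \<in> space M. f (X \<omega>) > expectation (\<lambda>\<omega>. f (X \<omega>)) + t} \<le> exp (- (t\<^sup>2 / (4 * D\<^sup>2)))"
proof -
  have [measurable]: "random_variable borel (\<lambda>\<omega>. X \<omega> \<bullet> b)" if "b \<in> Basis" for b
    using ind that by (auto simp: indep_vars_def)
  have X_eq: "(\<Sum>b\<in>Basis. (X \<omega> \<bullet> b) *\<^sub>R b) = X \<omega>" for \<omega>
    by (rule euclidean_representation)
  have "random_variable borel (\<lambda>\<omega>. \<Sum>b\<in>Basis. (X \<omega> \<bullet> b) *\<^sub>R b)"
    by (intro borel_measurable_sum) simp
  then have X[measurable]: "random_variable borel X"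
    by (simp only: X_eq)
  have [measurable]: "f \<in> borel_measurable borel"
    by (rule borel_measurable_continuous_onI[OF lipschitz_on_continuous_on[OF L]])
  have XR: "norm (X \<omega>) \<le> DIM('b) * (D / 2)" for \<omega>
    using norm_le_l1[of "X \<omega>"] sum_bounded_above[of Basis "\<lambda>b. \<bar>X \<omega> \<bullet> b\<bar>" "D / 2"] bound
    by (simp del: inner_Basis)
  have int_f: "integrable M (\<lambda>\<omega>. f (X \<omega>))"
  proof (rule integrable_const_bound[where B = "\<bar>f 0\<bar> + DIM('b) * (D / 2)"])
    have "\<bar>f (X \<omega>)\<bar> \<le> \<bar>f 0\<bar> + DIM('b) * (D / 2)" for \<omega>
      using lipschitz_onD[OF L, of "X \<omega>" 0] XR[of \<omega>] by (simp add: dist_norm)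
    then show "AE \<omega> in M. norm (f (X \<omega>)) \<le> \<bar>f 0\<bar> + DIM('b) * (D / 2)" by simp
  qed measurable
  \<comment> \<open>This value minimises the final exponent \<open>c^2 * D^2 - c * t\<close>; the
    minimum is \<open>- (t^2 / (4 * D^2))\<close>.\<close>
  define c where "c = t / (2 * D\<^sup>2)"
  have c: "0 < c"
    using t D by (simp add: c_def)
  have Lc: "c-lipschitz_on UNIV (\<lambda>x. c * f x)"
    using lipschitz_on_cmult_real_nonneg[OF L, of c] c by simp
  have convc: "convex_on UNIV (\<lambda>x. c * f x)"
    using convex_on_cmul[OF _ conv, of c] c by simp
  have Lmc: "c-lipschitz_on UNIV (\<lambda>x. - (c * f x))"
    using Lc by (rule lipschitz_on_minus)
  note int_exp = integrable_exp_lipschitz[OF Lc X XR] integrable_exp_lipschitz[OF Lmc X XR]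
  define m where "m = expectation (\<lambda>\<omega>. f (X \<omega>))"
  let ?Q = "inf_conv D (span Basis) (\<lambda>x. c * f x)"
  have LQ: "c-lipschitz_on UNIV ?Q"
    by (rule inf_conv_lipschitz[OF Lc D]) simp
  have Q_ge: "c * f x - c\<^sup>2 * D\<^sup>2 \<le> ?Q x" for x
    by (rule inf_conv_ge[OF Lc D]) simp
  have "expectation (\<lambda>\<omega>. exp (?Q (X \<omega>))) * expectation (\<lambda>\<omega>. exp (- (c * f (X \<omega>)))) \<le> 1"
    using maurey_property_sum[OF D subset_refl ind bound Lc convc] by (simp only: X_eq)
  \<comment> \<open>Jensen's inequality, obtained by integrating the tangent line of
    \<open>exp\<close> at \<open>- (c * m)\<close>; its linear term has mean zero.\<close>
  moreover have "exp (- (c * m)) \<le> expectation (\<lambda>\<omega>. exp (- (c * f (X \<omega>))))"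
  proof -
    have tangent: "exp (- (c * m)) * (1 - c * (f (X \<omega>) - m)) \<le> exp (- (c * f (X \<omega>)))" for \<omega>
    proof -
      have "exp (- (c * m)) * (1 - c * (f (X \<omega>) - m)) \<le> exp (- (c * m)) * exp (- (c * (f (X \<omega>) - m)))"
        using exp_ge_add_one_self[of "- (c * (f (X \<omega>) - m))"] by simp
      then show ?thesis
        by (simp add: algebra_simps flip: exp_add)
    qed
    have "exp (- (c * m)) = expectation (\<lambda>\<omega>. exp (- (c * m)) * (1 - c * (f (X \<omega>) - m)))"
      using int_f by (simp add: m_def prob_space)
    also have "\<dots> \<le> expectation (\<lambda>\<omega>. exp (- (c * f (X \<omega>))))"
      using int_f tangent by (intro integral_mono int_exp) auto
    finally show ?thesis .
  qed
  moreover have "exp (- (c\<^sup>2 * D\<^sup>2)) * expectation (\<lambda>\<omega>. exp (c * f (X \<omega>)))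
      \<le> expectation (\<lambda>\<omega>. exp (?Q (X \<omega>)))"
  proof -
    have "exp (- (c\<^sup>2 * D\<^sup>2)) * expectation (\<lambda>\<omega>. exp (c * f (X \<omega>)))
        = expectation (\<lambda>\<omega>. exp (- (c\<^sup>2 * D\<^sup>2)) * exp (c * f (X \<omega>)))"
      by simp
    also have "\<dots> \<le> expectation (\<lambda>\<omega>. exp (?Q (X \<omega>)))"
    proof (rule integral_mono)
      show "exp (- (c\<^sup>2 * D\<^sup>2)) * exp (c * f (X \<omega>)) \<le> exp (?Q (X \<omega>))" for \<omega>
        using Q_ge[of "X \<omega>"] by (simp flip: exp_add)
    qed (use int_exp(1) integrable_exp_lipschitz[OF LQ X XR] in simp_all)
    finally show ?thesis .
  qed
  moreover have "0 \<le> expectation (\<lambda>\<omega>. exp (?Q (X \<omega>)))"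
    by simp
  \<comment> \<open>Both factors in Maurey's inequality are replaced by their lower bounds.\<close>
  ultimately have "(exp (- (c\<^sup>2 * D\<^sup>2)) * expectation (\<lambda>\<omega>. exp (c * f (X \<omega>)))) * exp (- (c * m)) \<le> 1"
    by (smt (verit) mult_mono exp_ge_zero)
  then have mgf: "expectation (\<lambda>\<omega>. exp (c * f (X \<omega>))) \<le> exp (c\<^sup>2 * D\<^sup>2 + c * m)"
    by (simp add: exp_minus exp_add field_simps)
  let ?E = "{\<omega> \<in> space M. f (X \<omega>) > m + t}"
  have "prob ?E = expectation (indicator ?E)"
    by simp
  \<comment> \<open>Markov's inequality, proved by dominating the indicator pointwise by
    \<open>exp (c * (f (X \<omega>) - m - t))\<close>.\<close>
  also have "\<dots> \<le> expectation (\<lambda>\<omega>. exp (- (c * (m + t))) * exp (c * f (X \<omega>)))"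
  proof (rule integral_mono)
    show "integrable M (indicator ?E :: 'a \<Rightarrow> real)"
      by (intro integrable_real_indicator) (auto simp: less_top[symmetric])
    show "indicator ?E \<omega> \<le> exp (- (c * (m + t))) * exp (c * f (X \<omega>))" for \<omega>
      using c by (auto simp: indicator_def simp flip: exp_add)
  qed (use int_exp in simp)
  also have "\<dots> = exp (- (c * (m + t))) * expectation (\<lambda>\<omega>. exp (c * f (X \<omega>)))"
    by simp
  also have "\<dots> \<le> exp (- (c * (m + t))) * exp (c\<^sup>2 * D\<^sup>2 + c * m)"
    using mgf by simp
  also have "\<dots> = exp (c\<^sup>2 * D\<^sup>2 - c * t)"
    by (simp add: algebra_simps flip: exp_add)
  also have "c\<^sup>2 * D\<^sup>2 - c * t = - (t\<^sup>2 / (4 * D\<^sup>2))"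
    using D by (simp add: c_def field_simps power2_eq_square)
  finally show ?thesis
    by (simp only: m_def)
qed

text \<open>Clamping every coordinate to \<open>[-D/2, D/2]\<close> makes the bound hold everywhere,
  preserves independence because it acts coordinatewise, and changes \<open>X\<close> only on a null
  set.\<close>

lemma (in prob_space) convex_lipschitz_concentration_AE:
  fixes X :: "'a \<Rightarrow> 'b::euclidean_space"
  assumes D: "D > 0"
    and ind: "indep_vars (\<lambda>_. borel) (\<lambda>b \<omega>. X \<omega> \<bullet> b) Basis"
    and bound: "\<And>b. b \<in> Basis \<Longrightarrow> AE \<omega> in M. \<bar>X \<omega> \<bullet> b\<bar> \<le> D / 2"
    and L: "1-lipschitz_on UNIV f"
    and conv: "convex_on UNIV f"
    and t: "t > 0"
  shows "prob {\<omega> \<in> space M. f (X \<omega>) > expectation (\<lambda>\<omega>. f (X \<omega>)) + t} \<le> exp (- (t\<^sup>2 / (4 * D\<^sup>2)))"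
proof -
  define clamp where "clamp x = max (- (D / 2)) (min (D / 2) x)" for x :: real
  define Z where "Z \<omega> = (\<Sum>b\<in>Basis. clamp (X \<omega> \<bullet> b) *\<^sub>R b)" for \<omega>
  have [measurable]: "clamp \<in> borel_measurable borel"
    unfolding clamp_def by measurable
  have rv: "random_variable borel (\<lambda>\<omega>. X \<omega> \<bullet> b)" if "b \<in> Basis" for b
    using ind that by (auto simp: indep_vars_def)
  note [measurable] = rv
  have "random_variable borel (\<lambda>\<omega>. \<Sum>b\<in>Basis. (X \<omega> \<bullet> b) *\<^sub>R b)"
    by (intro borel_measurable_sum) simp
  then have X[measurable]: "random_variable borel X"
    by (simp only: euclidean_representation)
  have [measurable]: "random_variable borel Z"
    unfolding Z_def by (intro borel_measurable_sum) simp
  have [measurable]: "f \<in> borel_measurable borel"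
    by (rule borel_measurable_continuous_onI[OF lipschitz_on_continuous_on[OF L]])
  have Z_inner: "Z \<omega> \<bullet> b = clamp (X \<omega> \<bullet> b)" if "b \<in> Basis" for b \<omega>
    using that by (simp add: Z_def inner_sum_left_Basis)
  have "AE \<omega> in M. \<forall>b\<in>Basis. \<bar>X \<omega> \<bullet> b\<bar> \<le> D / 2"
    using bound by (intro AE_finite_allI) auto
  then have AE: "AE \<omega> in M. X \<omega> = Z \<omega>"
  proof eventually_elim
    case (elim \<omega>)
    then have "clamp (X \<omega> \<bullet> b) = X \<omega> \<bullet> b" if "b \<in> Basis" for b
      using that by (auto simp: clamp_def abs_le_iff min_def max_def)
    with Z_inner show "X \<omega> = Z \<omega>"
      by (subst euclidean_eq_iff) simp
  qed
  have ind_Z: "indep_vars (\<lambda>_. borel) (\<lambda>b \<omega>. Z \<omega> \<bullet> b) Basis"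
  proof (rule indep_vars_cong[THEN iffD1, OF refl _ refl])
    show "indep_vars (\<lambda>_. borel) (\<lambda>b \<omega>. clamp (X \<omega> \<bullet> b)) Basis"
      using indep_vars_compose2[OF ind, where Y = "\<lambda>_. clamp" and N = "\<lambda>_. borel"] by simp
  qed (simp add: Z_inner)
  have E_eq: "expectation (\<lambda>\<omega>. f (X \<omega>)) = expectation (\<lambda>\<omega>. f (Z \<omega>))"
    using AE by (intro integral_cong_AE) auto
  have "prob {\<omega> \<in> space M. f (X \<omega>) > expectation (\<lambda>\<omega>. f (X \<omega>)) + t}
      = prob {\<omega> \<in> space M. f (Z \<omega>) > expectation (\<lambda>\<omega>. f (Z \<omega>)) + t}"
    unfolding E_eq using AE by (intro measure_eq_AE) auto
  also have "\<dots> \<le> exp (- (t\<^sup>2 / (4 * D\<^sup>2)))"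
  proof (rule convex_lipschitz_concentration[OF D ind_Z _ L conv t])
    show "\<bar>Z \<omega> \<bullet> b\<bar> \<le> D / 2" if "b \<in> Basis" for b \<omega>
      using D by (auto simp: Z_inner[OF that] clamp_def)
  qed
  finally show ?thesis .
qed

section \<open>The spectral norm as a convex Lipschitz function\<close>

text \<open>The norm of the nested vector type is the Frobenius norm, so Cauchy-Schwarz applied to
  each row suffices.\<close>

lemma norm_matrix_vector_mult_le:
  fixes A :: "real^'n^'m"
  shows "norm (A *v v) \<le> norm A * norm v"
proof -
  have "norm (A *v v) = L2_set (\<lambda>i. \<bar>A $ i \<bullet> v\<bar>) UNIV"
    by (simp add: norm_vec_def matrix_vector_mul_component)
  also have "\<dots> \<le> L2_set (\<lambda>i. norm (A $ i) * norm v) UNIV"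
    by (intro L2_set_mono Cauchy_Schwarz_ineq2) simp
  also have "\<dots> = norm A * norm v"
    by (simp add: norm_vec_def L2_set_left_distrib)
  finally show ?thesis .
qed

lemma spectral_norm_triangle: "spectral_norm (A + B) \<le> spectral_norm A + spectral_norm B"
  unfolding spectral_norm_eq_onorm matrix_vector_mult_add_rdistrib
  by (rule onorm_triangle) (simp_all add: linear_linear)

lemma spectral_norm_scaleR: "spectral_norm (c *\<^sub>R A) = \<bar>c\<bar> * spectral_norm A"
  unfolding spectral_norm_eq_onorm scaleR_matrix_vector_assoc[symmetric]
  by (rule onorm_scaleR) (simp add: linear_linear)

lemma spectral_norm_le_norm: "spectral_norm A \<le> norm A"
  unfolding spectral_norm_eq_onorm by (intro onorm_bound norm_matrix_vector_mult_le) simp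

lemma spectral_norm_diff_lipschitz: "1-lipschitz_on UNIV (\<lambda>x. spectral_norm (A - x))"
proof (rule lipschitz_onI)
  have *: "spectral_norm (A - x) \<le> spectral_norm (A - y) + dist x y" for x y
    using spectral_norm_triangle[of "A - y" "y - x"] spectral_norm_le_norm[of "y - x"]
    by (simp add: dist_norm norm_minus_commute)
  fix x y
  show "dist (spectral_norm (A - x)) (spectral_norm (A - y)) \<le> 1 * dist x y"
    using *[of x y] *[of y x] by (simp add: dist_real_def dist_commute abs_le_iff)
qed simp

lemma spectral_norm_diff_convex:
  fixes A :: "real^'n^'m"
  shows "convex_on UNIV (\<lambda>x. spectral_norm (A - x))"
proof (rule convex_onI)
  fix t :: real and x y :: "real^'n^'m"
  assume t: "0 < t" "t < 1"
  have "A - ((1 - t) *\<^sub>R x + t *\<^sub>R y) = (1 - t) *\<^sub>R (A - x) + t *\<^sub>R (A - y)"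
    by (simp add: algebra_simps)
  then show "spectral_norm (A - ((1 - t) *\<^sub>R x + t *\<^sub>R y))
      \<le> (1 - t) * spectral_norm (A - x) + t * spectral_norm (A - y)"
    using spectral_norm_triangle[of "(1 - t) *\<^sub>R (A - x)" "t *\<^sub>R (A - y)"] t
    by (simp add: spectral_norm_scaleR)
qed simp

section \<open>From matrix entries to Euclidean coordinates\<close>

text \<open>Injectivity turns a finite subfamily over \<open>J\<close> into one over
  \<open>I\<close> with the same distinct factors. This is used to pass from index pairs to basis
  vectors.\<close>

lemma (in prob_space) indep_vars_reindex:
  assumes ind: "indep_vars N X I" and g: "inj_on g J" "g ` J \<subseteq> I"
  shows "indep_vars (\<lambda>j. N (g j)) (\<lambda>j. X (g j)) J"
  unfolding indep_vars_def2
proof (intro conjI ballI indep_setsI)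
  show "random_variable (N (g j)) (X (g j))" if "j \<in> J" for j
    using ind g that by (auto simp: indep_vars_def2)
  show "{X (g j) -` A \<inter> space M |A. A \<in> sets (N (g j))} \<subseteq> events" if "j \<in> J" for j
  proof -
    have "random_variable (N (g j)) (X (g j))"
      using ind g(2) that by (auto simp: indep_vars_def2)
    then show ?thesis by (auto intro: measurable_sets)
  qed
next
  fix A K
  assume K: "K \<noteq> {}" "K \<subseteq> J" "finite K"
    and A: "\<forall>j\<in>K. A j \<in> {X (g j) -` A \<inter> space M |A. A \<in> sets (N (g j))}"
  have inj: "inj_on g K"
    using g(1) K(2) by (rule inj_on_subset)
  let ?A = "\<lambda>i. A (inv_into K g i)"
  have "prob (\<Inter>i\<in>g ` K. ?A i) = (\<Prod>i\<in>g ` K. prob (?A i))"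
  proof (rule indep_setsD)
    show "indep_sets (\<lambda>i. {X i -` A \<inter> space M |A. A \<in> sets (N i)}) I"
      using ind by (simp add: indep_vars_def2)
    show "g ` K \<subseteq> I" "g ` K \<noteq> {}" "finite (g ` K)"
      using K g(2) by auto
    show "\<forall>i\<in>g ` K. ?A i \<in> {X i -` A \<inter> space M |A. A \<in> sets (N i)}"
      using A inj by simp
  qed
  then show "prob (\<Inter>j\<in>K. A j) = (\<Prod>j\<in>K. prob (A j))"
    using inj by (simp add: prod.reindex)
qed

theorem theorem6:
  fixes M :: "'a measure"
    and A :: "real^'n^'m"
    and X :: "'a \<Rightarrow> real^'n^'m"
    and D t :: real
  assumes "prob_space M"
    and "prob_space.indep_vars M (\<lambda>_. borel) (\<lambda>(j, k) \<omega>. X \<omega> $ j $ k) UNIV"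
    and "matrix_expectation M X = A"
    and "D > 0"
    and "\<And>j k. AE \<omega> in M. \<bar>X \<omega> $ j $ k\<bar> \<le> D / 2"
    and "t > 0"
  shows "\<P>(\<omega> in M. spectral_norm (A - X \<omega>)
             > prob_space.expectation M (\<lambda>\<omega>. spectral_norm (A - X \<omega>)) + t)
         \<le> exp (- (t\<^sup>2 / (4 * D\<^sup>2)))"
proof -
  interpret prob_space M by fact
  \<comment> \<open>The matrix units form the standard basis, and the inner product with one of them
    reads off the corresponding entry.\<close>
  let ?e = "\<lambda>(j, k). axis j (axis k 1) :: real^'n^'m"
  have Basis: "Basis = range ?e"
    by (auto simp: Basis_vec_def)
  have inj: "inj ?e"
    by (auto simp: inj_def axis_eq_axis)
  have comp: "X \<omega> \<bullet> ?e i = (case i of (j, k) \<Rightarrow> X \<omega> $ j $ k)" for \<omega> i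
    by (cases i) (simp add: inner_axis)
  have "indep_vars (\<lambda>_. borel) (\<lambda>b. (\<lambda>(j, k) \<omega>. X \<omega> $ j $ k) (inv ?e b)) Basis"
    using indep_vars_reindex[OF assms(2), of "inv ?e" Basis] inj
    by (simp add: Basis inj_on_inv_into)
  moreover have "(\<lambda>(j, k) \<omega>. X \<omega> $ j $ k) (inv ?e b) = (\<lambda>\<omega>. X \<omega> \<bullet> b)"
    if b: "b \<in> Basis" for b
  proof -
    obtain i where "b = ?e i"
      using b unfolding Basis by blast
    then show ?thesis
      using inv_f_f[OF inj, of i] comp[of _ i] by (cases i) (simp only: prod.case)
  qed
  ultimately have ind: "indep_vars (\<lambda>_. borel) (\<lambda>b \<omega>. X \<omega> \<bullet> b) Basis"
    by (subst indep_vars_cong[OF refl _ refl]) auto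
  show ?thesis
  proof (rule convex_lipschitz_concentration_AE[OF assms(4) ind _
        spectral_norm_diff_lipschitz spectral_norm_diff_convex assms(6)])
    show "AE \<omega> in M. \<bar>X \<omega> \<bullet> b\<bar> \<le> D / 2" if "b \<in> Basis" for b
      using that assms(5) comp unfolding Basis by auto
  qed
qed

end
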